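(* Let $k,n\in\mathbb{N}$ and $\mathbf{z}=(z_1,\dots,z_d)\in\mathbb{Z}^d$, and let $\Lambda=\mathcal{S}_{\mathbf{1},k}=\{\mathbf{h}\in\mathbb{N}_0^d:\sum_{j=1}^d h_j\le k\}$. The following statements are equivalent: (i) $(n,\mathbf{z})$ is admissible for Plan A for $\Lambda$; (ii) $(n,\mathbf{z})$ is admissible for Plan B for $\Lambda$; (iii) $(n,\mathbf{z})$ is admissible for Plan C for $\Lambda$ and $2k z_j\not\equiv_n0$ for all $j=1,\dots,d$. Moreover, if $n$ is odd, the condition "$2kz_j\not\equiv_n0$ for all $j=1,\dots,d$" in (iii) is not needed, i.e. (i) and (ii) are equivalent to admissibility of $(n,\mathbf{z})$ for Plan C for $\Lambda$.
   Context: $\mathbb{N}=\{1,2,\dots\}$, $\mathbb{N}_0=\mathbb{N}\cup\{0\}$; $a\equiv_n b$ means $a\equiv b\pmod n$. For $\mathbf{h}\in\mathbb{N}_0^d$, $\mathcal{S}_{\mathbf{h}}$ is the set of the $2^{|\mathbf{h}|_0}$ component-wise sign changes acting on the nonzero coordinates of $\mathbf{h}$ (including the identity), where $|\mathbf{h}|_0$ is the number of nonzero coordinates. The mirrored set of $\Lambda\subset\mathbb{N}_0^d$ is $\mathcal{M}(\Lambda)=\{\sigma(\mathbf{h}):\mathbf{h}\in\Lambda,\ \sigma\in\mathcal{S}_{\mathbf{h}}\}$. A pair $(n,\mathbf{z})\in\mathbb{N}\times\mathbb{Z}^d$ is, for $\Lambda$: - admissible for Plan A if $\mathbf{h}\cdot\mathbf{z}\not\equiv_n\mathbf{h}'\cdot\mathbf{z}$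 for all $\mathbf{h}\ne\mathbf{h}'\in\mathcal{M}(\Lambda)$; - admissible for Plan B if $\sigma(\mathbf{h})\cdot\mathbf{z}\not\equiv_n\mathbf{h}'\cdot\mathbf{z}$ for all $\mathbf{h},\mathbf{h}'\in\Lambda$ and $\sigma\in\mathcal{S}_{\mathbf{h}}$ with $\sigma(\mathbf{h})\ne\mathbf{h}'$; - admissible for Plan C if $\sigma(\mathbf{h})\cdot\mathbf{z}\not\equiv_n\mathbf{h}'\cdot\mathbf{z}$ for all $\mathbf{h},\mathbf{h}'\in\Lambda$ and $\sigma\in\mathcal{S}_{\mathbf{h}}$ with $\mathbf{h}\ne\mathbf{h}'$. *)

theory Defs
  imports "HOL-Analysis.Analysis" "HOL-Number_Theory.Cong"
begin

definition int_vec :: "nat ^ 'd \<Rightarrow> int ^ 'd" where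
  "int_vec h = (\<chi> j. int (h $ j))"

(* A sign change is encoded by its vector of signs. The entries at zero coordinates of h are
   fixed to 1, so that distinct vectors are distinct sign changes; see card_sign_changes. *)
definition sign_changes :: "nat ^ 'd \<Rightarrow> (int ^ 'd) set" where
  "sign_changes h = {\<sigma>. \<forall>j. \<sigma> $ j \<in> {1, -1} \<and> (h $ j = 0 \<longrightarrow> \<sigma> $ j = 1)}"

definition apply_sign :: "int ^ 'd \<Rightarrow> nat ^ 'd \<Rightarrow> int ^ 'd" where
  "apply_sign \<sigma> h = (\<chi> j. \<sigma> $ j * int (h $ j))"

definition mirrored :: "(nat ^ 'd) set \<Rightarrow> (int ^ 'd) set" where
  "mirrored \<Lambda> = {apply_sign \<sigma> h | h \<sigma>. h \<in> \<Lambda> \<and> \<sigma> \<in> sign_changes h}"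

definition admissible_A :: "(nat ^ 'd) set \<Rightarrow> nat \<Rightarrow> int ^ 'd \<Rightarrow> bool" where
  "admissible_A \<Lambda> n z \<longleftrightarrow>
    (\<forall>h \<in> mirrored \<Lambda>. \<forall>h' \<in> mirrored \<Lambda>. h \<noteq> h' \<longrightarrow>
      \<not> [scalar_product h z = scalar_product h' z] (mod int n))"

definition admissible_B :: "(nat ^ 'd) set \<Rightarrow> nat \<Rightarrow> int ^ 'd \<Rightarrow> bool" where
  "admissible_B \<Lambda> n z \<longleftrightarrow>
    (\<forall>h \<in> \<Lambda>. \<forall>h' \<in> \<Lambda>. \<forall>\<sigma> \<in> sign_changes h. apply_sign \<sigma> h \<noteq> int_vec h' \<longrightarrow>
      \<not> [scalar_product (apply_sign \<sigma> h) z = scalar_product (int_vec h') z] (mod int n))"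

definition admissible_C :: "(nat ^ 'd) set \<Rightarrow> nat \<Rightarrow> int ^ 'd \<Rightarrow> bool" where
  "admissible_C \<Lambda> n z \<longleftrightarrow>
    (\<forall>h \<in> \<Lambda>. \<forall>h' \<in> \<Lambda>. \<forall>\<sigma> \<in> sign_changes h. h \<noteq> h' \<longrightarrow>
      \<not> [scalar_product (apply_sign \<sigma> h) z = scalar_product (int_vec h') z] (mod int n))"

definition index_simplex :: "nat \<Rightarrow> (nat ^ 'd) set" where
  "index_simplex k = {h. (\<Sum>j\<in>UNIV. h $ j) \<le> k}"

lemma card_sign_changes: "card (sign_changes h) = 2 ^ card {j. h $ j \<noteq> 0}"
proof -
  have "bij_betw (\<lambda>\<sigma>. {j. \<sigma> $ j = -1}) (sign_changes h) (Pow {j. h $ j \<noteq> 0})"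
  proof (rule bij_betwI[where g = "\<lambda>S. \<chi> j. if j \<in> S then -1 else 1"])
    show "(\<lambda>\<sigma>. {j. \<sigma> $ j = -1}) \<in> sign_changes h \<rightarrow> Pow {j. h $ j \<noteq> 0}"
      by (auto simp: sign_changes_def)
    show "(\<lambda>S. \<chi> j. if j \<in> S then -1 else 1) \<in> Pow {j. h $ j \<noteq> 0} \<rightarrow> sign_changes h"
      by (auto simp: sign_changes_def)
  next
    fix \<sigma> assume "\<sigma> \<in> sign_changes h"
    then show "(\<chi> j. if j \<in> {j. \<sigma> $ j = -1} then -1 else 1) = \<sigma>"
      by (auto simp: sign_changes_def vec_eq_iff)
  next
    fix S assume "S \<in> Pow {j. h $ j \<noteq> 0}"
    then show "{j. (\<chi> j. if j \<in> S then -1 else (1::int)) $ j = -1} = S"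
      by auto
  qed
  then show ?thesis
    by (simp add: bij_betw_same_card card_Pow)
qed

end

theory Submission
  imports Defs
begin

text \<open>
  For \<open>index_simplex k\<close> the mirrored set is the integer \<open>\<ell>\<^sup>1\<close>-ball of radius \<open>k\<close>, so Plan A forbids
  exactly the nonzero zeros \<open>w\<close> of \<open>w \<mapsto> w \<cdot> z mod n\<close> in the ball of radius \<open>2k\<close>. Up to a sign, the
  positive part of such a \<open>w\<close> dominates its negative part; cutting off a piece \<open>u\<close> of size at most \<open>k\<close>
  from the positive part writes \<open>w = u - g\<close> with \<open>g\<close> in the ball of radius \<open>k\<close>, which Plan B forbids.
  Plan B exceeds Plan C by forbidding \<open>w = 2u\<close> for \<open>u \<noteq> 0\<close> in the simplex. Unless \<open>u = k e\<^sub>j\<close>, one can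
  write \<open>2u = a + b\<close> with distinct \<open>a\<close>, \<open>b\<close> in the simplex, and Plan C separates \<open>-a\<close> from \<open>b\<close>.
\<close>

section \<open>Scalar products, signed versions and the mirrored simplex\<close>

lemma scalar_product_diff_left:
  fixes x y z :: "int ^ 'd"
  shows "scalar_product (x - y) z = scalar_product x z - scalar_product y z"
  by (simp add: scalar_product_def left_diff_distrib sum_subtractf)

lemma scalar_product_axis:
  fixes z :: "int ^ 'd"
  shows "scalar_product (axis j c) z = c * z $ j"
proof -
  have "scalar_product (axis j c) z = (\<Sum>i\<in>UNIV. if i = j then c * z $ i else 0)"
    unfolding scalar_product_def by (rule sum.cong) (auto simp: axis_def)
  then show ?thesis by simp
qed

lemma sum_axis: "(\<Sum>i\<in>UNIV. (axis j c :: 'a::comm_monoid_add ^ 'd) $ i) = c"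
  by (simp add: axis_def)

text \<open>Trades sign vectors for a condition on absolute values, so that the plans can be tested
  on integer vectors directly.\<close>

lemma signed_versions:
  "(\<lambda>\<sigma>. apply_sign \<sigma> h) ` sign_changes h = {g. \<forall>j. \<bar>g $ j\<bar> = int (h $ j)}"
proof (intro equalityI subsetI)
  fix g assume "g \<in> (\<lambda>\<sigma>. apply_sign \<sigma> h) ` sign_changes h"
  then obtain \<sigma> where s: "\<sigma> \<in> sign_changes h" "g = apply_sign \<sigma> h" by blast
  have "\<bar>g $ j\<bar> = int (h $ j)" for j
  proof -
    have "\<sigma> $ j = 1 \<or> \<sigma> $ j = -1" using s(1) by (auto simp: sign_changes_def)
    then show ?thesis using s(2) by (auto simp: apply_sign_def)
  qed
  then show "g \<in> {g. \<forall>j. \<bar>g $ j\<bar> = int (h $ j)}" by simp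
next
  fix g assume "g \<in> {g. \<forall>j. \<bar>g $ j\<bar> = int (h $ j)}"
  then have a: "\<bar>g $ j\<bar> = int (h $ j)" for j by simp
  \<comment> \<open>The sign is 1 where \<open>g\<close> vanishes, as \<open>sign_changes\<close>
    demands at the zero coordinates of \<open>h\<close>.\<close>
  define \<sigma> :: "int ^ 'a" where "\<sigma> = (\<chi> j. if g $ j < 0 then -1 else 1)"
  have "g $ j = \<sigma> $ j * int (h $ j)" for j
    using a[of j] by (simp add: \<sigma>_def abs_if split: if_splits)
  then have "g = apply_sign \<sigma> h" by (simp add: apply_sign_def vec_eq_iff)
  moreover have "\<sigma> $ j = 1" if "h $ j = 0" for j
    using a[of j] that by (simp add: \<sigma>_def)
  then have "\<sigma> \<in> sign_changes h"
    by (simp add: sign_changes_def) (simp add: \<sigma>_def)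
  ultimately show "g \<in> (\<lambda>\<sigma>. apply_sign \<sigma> h) ` sign_changes h" by blast
qed

lemma admissible_B_iff:
  "admissible_B \<Lambda> n z \<longleftrightarrow>
    (\<forall>h\<in>\<Lambda>. \<forall>h'\<in>\<Lambda>. \<forall>g. (\<forall>j. \<bar>g $ j\<bar> = int (h $ j)) \<longrightarrow> g \<noteq> int_vec h' \<longrightarrow>
      \<not> [scalar_product g z = scalar_product (int_vec h') z] (mod int n))"
proof -
  have "admissible_B \<Lambda> n z \<longleftrightarrow>
    (\<forall>h\<in>\<Lambda>. \<forall>h'\<in>\<Lambda>. \<forall>g \<in> (\<lambda>\<sigma>. apply_sign \<sigma> h) ` sign_changes h. g \<noteq> int_vec h' \<longrightarrow>
      \<not> [scalar_product g z = scalar_product (int_vec h') z] (mod int n))"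
    by (simp add: admissible_B_def)
  then show ?thesis unfolding signed_versions by blast
qed

lemma admissible_C_iff:
  "admissible_C \<Lambda> n z \<longleftrightarrow>
    (\<forall>h\<in>\<Lambda>. \<forall>h'\<in>\<Lambda>. \<forall>g. (\<forall>j. \<bar>g $ j\<bar> = int (h $ j)) \<longrightarrow> h \<noteq> h' \<longrightarrow>
      \<not> [scalar_product g z = scalar_product (int_vec h') z] (mod int n))"
proof -
  have "admissible_C \<Lambda> n z \<longleftrightarrow>
    (\<forall>h\<in>\<Lambda>. \<forall>h'\<in>\<Lambda>. \<forall>g \<in> (\<lambda>\<sigma>. apply_sign \<sigma> h) ` sign_changes h. h \<noteq> h' \<longrightarrow>
      \<not> [scalar_product g z = scalar_product (int_vec h') z] (mod int n))"
    by (simp add: admissible_C_def)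
  then show ?thesis unfolding signed_versions by blast
qed

lemma mirrored_index_simplex:
  "mirrored (index_simplex k :: (nat ^ 'd) set) = {g. (\<Sum>j\<in>UNIV. \<bar>g $ j\<bar>) \<le> int k}"
proof -
  have "mirrored (index_simplex k :: (nat ^ 'd) set) =
      (\<Union>h\<in>index_simplex k. (\<lambda>\<sigma>. apply_sign \<sigma> h) ` sign_changes h)"
    by (auto simp: mirrored_def)
  also have "\<dots> = {g. \<exists>h :: nat ^ 'd. (\<Sum>j\<in>UNIV. h $ j) \<le> k \<and> (\<forall>j. \<bar>g $ j\<bar> = int (h $ j))}"
    unfolding signed_versions by (auto simp: index_simplex_def)
  also have "\<dots> = {g :: int ^ 'd. (\<Sum>j\<in>UNIV. \<bar>g $ j\<bar>) \<le> int k}"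
  proof (rule Collect_cong, rule iffI)
    fix g :: "int ^ 'd"
    assume "\<exists>h :: nat ^ 'd. (\<Sum>j\<in>UNIV. h $ j) \<le> k \<and> (\<forall>j. \<bar>g $ j\<bar> = int (h $ j))"
    then show "(\<Sum>j\<in>UNIV. \<bar>g $ j\<bar>) \<le> int k"
      by (metis (no_types, lifting) of_nat_le_iff of_nat_sum sum.cong)
  next
    fix g :: "int ^ 'd"
    assume "(\<Sum>j\<in>UNIV. \<bar>g $ j\<bar>) \<le> int k"
    then have "int (\<Sum>j\<in>UNIV. (\<chi> j. nat \<bar>g $ j\<bar>) $ j) \<le> int k" by simp
    then have "(\<Sum>j\<in>UNIV. (\<chi> j. nat \<bar>g $ j\<bar>) $ j) \<le> k"
      unfolding of_nat_le_iff .
    moreover have "\<forall>j. \<bar>g $ j\<bar> = int ((\<chi> j. nat \<bar>g $ j\<bar>) $ j)" by simp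
    ultimately show "\<exists>h. (\<Sum>j\<in>UNIV. h $ j) \<le> k \<and> (\<forall>j. \<bar>g $ j\<bar> = int (h $ j))" by blast
  qed
  finally show ?thesis .
qed

section \<open>Plan A and Plan B\<close>

lemma admissible_B_index_simplexD:
  assumes "admissible_B (index_simplex k) n z"
    and "(\<Sum>j\<in>UNIV. \<bar>g $ j\<bar>) \<le> int k" and "h \<in> index_simplex k" and "g \<noteq> int_vec h"
  shows "\<not> [scalar_product g z = scalar_product (int_vec h) z] (mod int n)"
proof -
  have "g \<in> mirrored (index_simplex k)" using assms(2) by (simp add: mirrored_index_simplex)
  then show ?thesis using assms(1,3,4) unfolding mirrored_def admissible_B_def by blast
qed

text \<open>Supplies the piece to be cut off a positive part. It grows by one unit at a time, in a
  coordinate where \<open>u\<close> is still below \<open>p\<close>.\<close>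

lemma ex_subvector_sum:
  fixes p :: "nat ^ 'd"
  assumes "m \<le> (\<Sum>j\<in>UNIV. p $ j)"
  shows "\<exists>u. (\<forall>j. u $ j \<le> p $ j) \<and> (\<Sum>j\<in>UNIV. u $ j) = m"
  using assms
proof (induction m)
  case 0
  show ?case by (rule exI[of _ 0]) simp
next
  case (Suc m)
  then obtain u where u: "\<forall>j. u $ j \<le> p $ j" "(\<Sum>j\<in>UNIV. u $ j) = m" by auto
  have "\<exists>i. u $ i < p $ i"
  proof (rule ccontr)
    assume "\<nexists>i. u $ i < p $ i"
    then have "(\<Sum>j\<in>UNIV. p $ j) \<le> (\<Sum>j\<in>UNIV. u $ j)" by (intro sum_mono) (simp add: not_less)
    then show False using u(2) Suc.prems by simp
  qed
  then obtain i where "u $ i < p $ i" ..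
  then have "(u + axis i 1) $ j \<le> p $ j" for j
    using u(1) by (auto simp: axis_def)
  moreover have "(\<Sum>j\<in>UNIV. (u + axis i 1) $ j) = Suc m"
    using u(2) by (simp add: sum.distrib sum_axis)
  ultimately show ?case by blast
qed

text \<open>Let \<open>P\<close> and \<open>N\<close> be the sums of the positive and the negative
  part, so \<open>P + N\<close> is at most \<open>2 * k\<close> and \<open>N\<close> at most
  \<open>P\<close>. Cutting off \<open>min k P\<close> leaves norm \<open>P + N - k\<close> if
  \<open>P\<close> is at least \<open>k\<close>, and \<open>N\<close> otherwise; both are at most
  \<open>k\<close>.\<close>

lemma ex_split_larger_positive_part:
  fixes w :: "int ^ 'd"
  assumes "(\<Sum>j\<in>UNIV. \<bar>w $ j\<bar>) \<le> 2 * int k"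
    and "(\<Sum>j\<in>UNIV. w $ j) \<ge> 0"
  shows "\<exists>g u. u \<in> index_simplex k \<and> (\<Sum>j\<in>UNIV. \<bar>g $ j\<bar>) \<le> int k \<and> int_vec u - g = w"
proof -
  \<comment> \<open>The positive part of \<open>w\<close>: \<open>nat\<close> sends negative entries
    to 0.\<close>
  define p :: "nat ^ 'd" where "p = (\<chi> j. nat (w $ j))"
  define P where "P = (\<Sum>j\<in>UNIV. p $ j)"
  have "min k P \<le> (\<Sum>j\<in>UNIV. p $ j)" by (simp add: P_def)
  then obtain u where u: "\<forall>j. u $ j \<le> p $ j" "(\<Sum>j\<in>UNIV. u $ j) = min k P"
    using ex_subvector_sum by blast
  define g where "g = int_vec u - w"
  have abs_w: "\<bar>w $ j\<bar> = 2 * int (p $ j) - w $ j" for j by (simp add: p_def)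
  \<comment> \<open>Since \<open>u\<close> lies below the positive part, it vanishes where
    \<open>w\<close> is negative and never overshoots elsewhere, so no sign flips.\<close>
  have "\<bar>g $ j\<bar> = \<bar>w $ j\<bar> - int (u $ j)" for j
    using u(1)[rule_format, of j] by (auto simp: g_def int_vec_def p_def)
  then have "(\<Sum>j\<in>UNIV. \<bar>g $ j\<bar>) = (\<Sum>j\<in>UNIV. \<bar>w $ j\<bar>) - int (min k P)"
    using u(2) by (simp add: sum_subtractf flip: of_nat_sum)
  moreover have "(\<Sum>j\<in>UNIV. \<bar>w $ j\<bar>) = 2 * int P - (\<Sum>j\<in>UNIV. w $ j)"
    by (simp add: abs_w sum_subtractf P_def flip: sum_distrib_left of_nat_sum)
  ultimately have "(\<Sum>j\<in>UNIV. \<bar>g $ j\<bar>) \<le> int k" using assms by (simp add: min_def split: if_splits)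
  moreover have "u \<in> index_simplex k" using u(2) by (simp add: index_simplex_def)
  moreover have "int_vec u - g = w" by (simp add: g_def)
  ultimately show ?thesis by blast
qed

lemma admissible_A_imp_B: "admissible_A \<Lambda> n z \<Longrightarrow> admissible_B \<Lambda> n z"
proof -
  assume A: "admissible_A \<Lambda> n z"
  have "int_vec h \<in> mirrored \<Lambda>" if "h \<in> \<Lambda>" for h
  proof -
    have "int_vec h = apply_sign 1 h" "1 \<in> sign_changes h"
      by (auto simp: int_vec_def apply_sign_def sign_changes_def vec_eq_iff)
    then show ?thesis using that unfolding mirrored_def by blast
  qed
  moreover have "apply_sign \<sigma> h \<in> mirrored \<Lambda>" if "h \<in> \<Lambda>" "\<sigma> \<in> sign_changes h" for h \<sigma>
    using that unfolding mirrored_def by blast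
  ultimately show ?thesis using A unfolding admissible_A_def admissible_B_def by blast
qed

lemma admissible_B_imp_A_index_simplex:
  assumes "admissible_B (index_simplex k) n z"
  shows "admissible_A (index_simplex k) n z"
proof -
  \<comment> \<open>The splitting lemma wants a nonnegative coordinate sum of \<open>x - y\<close>;
    the opposite case follows by swapping \<open>x\<close> and \<open>y\<close>.\<close>
  have sep: "\<not> [scalar_product x z = scalar_product y z] (mod int n)"
    if x: "(\<Sum>j\<in>UNIV. \<bar>x $ j\<bar>) \<le> int k" and y: "(\<Sum>j\<in>UNIV. \<bar>y $ j\<bar>) \<le> int k"
      and "x \<noteq> y" and ge: "(\<Sum>j\<in>UNIV. (x - y) $ j) \<ge> 0" for x y
  proof
    assume c: "[scalar_product x z = scalar_product y z] (mod int n)"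
    have "(\<Sum>j\<in>UNIV. \<bar>(x - y) $ j\<bar>) \<le> (\<Sum>j\<in>UNIV. \<bar>x $ j\<bar> + \<bar>y $ j\<bar>)"
      by (intro sum_mono) simp
    then have "(\<Sum>j\<in>UNIV. \<bar>(x - y) $ j\<bar>) \<le> 2 * int k"
      using x y by (simp add: sum.distrib)
    then obtain g u where gu: "u \<in> index_simplex k" "(\<Sum>j\<in>UNIV. \<bar>g $ j\<bar>) \<le> int k"
      "int_vec u - g = x - y"
      using ex_split_larger_positive_part ge by blast
    have "scalar_product (int_vec u) z - scalar_product g z = scalar_product x z - scalar_product y z"
      using gu(3) by (metis scalar_product_diff_left)
    then have "[scalar_product (int_vec u) z = scalar_product g z] (mod int n)"
      using c by (simp add: cong_iff_dvd_diff)
    moreover have "g \<noteq> int_vec u" using gu(3) \<open>x \<noteq> y\<close> by auto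
    ultimately show False
      using admissible_B_index_simplexD[OF assms gu(2,1)] by (simp add: cong_sym)
  qed
  show ?thesis unfolding admissible_A_def mirrored_index_simplex
  proof (intro ballI impI)
    fix x y :: "int ^ 'a"
    assume xy: "x \<in> {g. (\<Sum>j\<in>UNIV. \<bar>g $ j\<bar>) \<le> int k}"
      "y \<in> {g. (\<Sum>j\<in>UNIV. \<bar>g $ j\<bar>) \<le> int k}" "x \<noteq> y"
    show "\<not> [scalar_product x z = scalar_product y z] (mod int n)"
    proof (cases "(\<Sum>j\<in>UNIV. (x - y) $ j) \<ge> 0")
      case True
      then show ?thesis using sep xy by blast
    next
      case False
      then have "(\<Sum>j\<in>UNIV. (y - x) $ j) \<ge> 0" by (simp add: sum_subtractf)
      then show ?thesis using sep[of y x] xy cong_sym by blast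
    qed
  qed
qed

section \<open>Plan B and Plan C\<close>

lemma admissible_B_imp_C: "admissible_B \<Lambda> n z \<Longrightarrow> admissible_C \<Lambda> n z"
  \<comment> \<open>Absolute values recover \<open>h\<close> from \<open>g\<close>, so
    \<open>g = int_vec h'\<close> would force \<open>h = h'\<close>.\<close>
  unfolding admissible_B_iff admissible_C_iff by (fastforce simp: int_vec_def vec_eq_iff)

text \<open>Plan B separates the opposite vertices \<open>axis j (- int k)\<close> and
  \<open>axis j (int k)\<close>, distinct because \<open>k\<close> is positive; their values differ
  by \<open>2 * k * z $ j\<close>.\<close>

lemma admissible_B_index_simplex_imp_not_cong:
  assumes "admissible_B (index_simplex k) n z" and "k \<ge> 1"
  shows "\<not> [2 * int k * z $ j = 0] (mod int n)"
proof -
  have "(\<Sum>i\<in>UNIV. \<bar>axis j (- int k) $ i\<bar>) = (\<Sum>i\<in>UNIV. axis j (int k) $ i)"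
    by (rule sum.cong) (auto simp: axis_def)
  then have "(\<Sum>i\<in>UNIV. \<bar>axis j (- int k) $ i\<bar>) \<le> int k" by (simp add: sum_axis)
  moreover have "axis j k \<in> index_simplex k" by (simp add: index_simplex_def sum_axis)
  moreover have iv: "int_vec (axis j k) = axis j (int k)"
    by (auto simp: int_vec_def axis_def vec_eq_iff)
  moreover have "axis j (- int k) \<noteq> axis j (int k)" using assms(2) by (simp add: axis_eq_axis)
  ultimately have "\<not> [scalar_product (axis j (- int k)) z = scalar_product (axis j (int k)) z] (mod int n)"
    using admissible_B_index_simplexD[OF assms(1)] by metis
  then show ?thesis
    by (simp add: scalar_product_axis cong_iff_dvd_diff algebra_simps flip: dvd_minus_iff[of "int n" "- _ - _"])
qed

text \<open>The vector \<open>-a\<close> is a signed version of \<open>a\<close>, so Plan C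
  separates it from \<open>b\<close>; the difference of the two values is the value of
  \<open>a + b\<close>.\<close>

lemma admissible_C_index_simplex_midpoint:
  fixes a b :: "nat ^ 'd"
  assumes "admissible_C (index_simplex k) n z"
    and "a \<in> index_simplex k" "b \<in> index_simplex k" "a \<noteq> b"
    and "int_vec a + int_vec b = v"
  shows "\<not> [scalar_product v z = 0] (mod int n)"
proof -
  have "\<not> [scalar_product (- int_vec a) z = scalar_product (int_vec b) z] (mod int n)"
    using assms(1-4) unfolding admissible_C_iff by (simp add: int_vec_def)
  moreover have "scalar_product v z = scalar_product (int_vec b) z - scalar_product (- int_vec a) z"
    using assms(5) by (simp flip: scalar_product_diff_left add: add.commute)
  ultimately show ?thesis by (simp add: cong_iff_dvd_diff dvd_diff_commute)
qed

lemma admissible_C_index_simplex_double: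
  fixes u :: "nat ^ 'd"
  assumes C: "admissible_C (index_simplex k) n z"
    and z: "\<And>j. \<not> [2 * int k * z $ j = 0] (mod int n)"
    and u: "u \<in> index_simplex k" "u \<noteq> 0"
  shows "\<not> [scalar_product (int_vec u + int_vec u) z = 0] (mod int n)"
proof -
  obtain j where j: "u $ j > 0" using u(2) by (auto simp: vec_eq_iff)
  define v where "v = u - axis j 1"
  \<comment> \<open>Subtraction on \<open>nat\<close> is truncated; the choice of \<open>j\<close>
    makes it exact here.\<close>
  have uv: "u = v + axis j 1" using j by (auto simp: v_def vec_eq_iff axis_def)
  have sum_u: "(\<Sum>i\<in>UNIV. u $ i) = (\<Sum>i\<in>UNIV. v $ i) + 1"
    by (simp add: uv sum.distrib sum_axis)
  have uk: "(\<Sum>i\<in>UNIV. u $ i) \<le> k" using u(1) by (simp add: index_simplex_def)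
  consider "(\<Sum>i\<in>UNIV. u $ i) < k" | i where "i \<noteq> j" "u $ i > 0"
    | "(\<Sum>i\<in>UNIV. u $ i) = k" "\<forall>i. i \<noteq> j \<longrightarrow> u $ i = 0"
    using uk by fastforce
  then show ?thesis
  proof cases
    case 1
    \<comment> \<open>There is room for one more unit: \<open>u\<close> is the midpoint of its two
      neighbours in direction \<open>j\<close>.\<close>
    have "v \<noteq> u + axis j 1" by (auto simp: uv vec_eq_iff axis_def)
    moreover have "int_vec v + int_vec (u + axis j 1) = int_vec u + int_vec u"
      by (auto simp: int_vec_def uv vec_eq_iff)
    moreover have "v \<in> index_simplex k" "u + axis j 1 \<in> index_simplex k"
      using 1 sum_u by (simp_all add: index_simplex_def sum.distrib sum_axis)
    ultimately show ?thesis using admissible_C_index_simplex_midpoint[OF C] by blast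
  next
    case (2 i)
    define w where "w = v - axis i 1"
    have vw: "v = w + axis i 1" using 2 by (auto simp: v_def w_def vec_eq_iff axis_def)
    \<comment> \<open>Moving a unit between coordinates \<open>i\<close> and \<open>j\<close>, in
      either direction, keeps the coordinate sum of \<open>u\<close> and gives two points with
      midpoint \<open>u\<close>.\<close>
    define a where "a = w + axis i 2"
    define b where "b = w + axis j 2"
    have "a \<noteq> b" using 2(1) by (auto simp: a_def b_def axis_eq_axis)
    moreover have "int_vec a + int_vec b = int_vec u + int_vec u"
      by (auto simp: int_vec_def a_def b_def uv vw vec_eq_iff axis_def)
    moreover have "a \<in> index_simplex k" "b \<in> index_simplex k"
      using uk by (simp_all add: a_def b_def uv vw index_simplex_def sum.distrib sum_axis)
    ultimately show ?thesis using admissible_C_index_simplex_midpoint[OF C] by blast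
  next
    case 3
    \<comment> \<open>A nonzero vertex of the simplex is no midpoint of two distinct simplex points;
      here the condition on \<open>z\<close> takes over.\<close>
    have u_axis: "u = axis j (u $ j)" using 3(2) by (auto simp: axis_def vec_eq_iff)
    then have "u $ j = k" using 3(1) by (metis sum_axis)
    then have "int_vec u + int_vec u = axis j (2 * int k)"
      using 3(2) by (auto simp: int_vec_def axis_def vec_eq_iff)
    then show ?thesis using z[of j] by (simp add: scalar_product_axis)
  qed
qed

lemma admissible_C_imp_B_index_simplex:
  fixes z :: "int ^ 'd"
  assumes C: "admissible_C (index_simplex k) n z"
    and z: "\<And>j. \<not> [2 * int k * z $ j = 0] (mod int n)"
  shows "admissible_B (index_simplex k) n z"
  unfolding admissible_B_iff
proof (intro ballI allI impI)
  fix h h' :: "nat ^ 'd" and g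
  assume h: "h \<in> index_simplex k" "h' \<in> index_simplex k" "\<forall>j. \<bar>g $ j\<bar> = int (h $ j)" "g \<noteq> int_vec h'"
  show "\<not> [scalar_product g z = scalar_product (int_vec h') z] (mod int n)"
  proof (cases "h = h'")
    case False
    then show ?thesis using C h unfolding admissible_C_iff by blast
  next
    case True
    \<comment> \<open>The part of \<open>h\<close> whose sign is flipped in \<open>g\<close>;
      flipping it changes the vector by twice that part.\<close>
    define u where "u = (\<chi> j. if g $ j < 0 then h $ j else 0)"
    have "int (h $ j) - g $ j = int (u $ j) + int (u $ j)" for j
      using h(3)[rule_format, of j] by (auto simp: u_def)
    then have d: "int_vec h - g = int_vec u + int_vec u"
      by (simp add: int_vec_def vec_eq_iff)
    have "u \<noteq> 0"
    proof
      assume "u = 0"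
      then have "int_vec h - g = 0" unfolding d by (simp add: int_vec_def vec_eq_iff)
      then show False using h(4) True by simp
    qed
    moreover have "u \<in> index_simplex k"
    proof -
      have "(\<Sum>j\<in>UNIV. u $ j) \<le> (\<Sum>j\<in>UNIV. h $ j)" by (intro sum_mono) (simp add: u_def)
      then show ?thesis using h(1) by (simp add: index_simplex_def)
    qed
    ultimately have "\<not> [scalar_product (int_vec h - g) z = 0] (mod int n)"
      using admissible_C_index_simplex_double[OF C z] d by metis
    then show ?thesis
      using True by (simp add: scalar_product_diff_left cong_iff_dvd_diff dvd_diff_commute)
  qed
qed

text \<open>For odd \<open>n\<close> the factor 2 cancels, so the congruence would make
  \<open>axis j k\<close> collide with the origin, which Plan C forbids.\<close>

lemma admissible_C_index_simplex_odd_imp_not_cong: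
  assumes C: "admissible_C (index_simplex k) n z" and "k \<ge> 1" and "odd n"
  shows "\<not> [2 * int k * z $ j = 0] (mod int n)"
proof
  assume "[2 * int k * z $ j = 0] (mod int n)"
  then have "int n dvd 2 * (int k * z $ j)" by (simp add: cong_0_iff mult.assoc)
  moreover have "coprime (int n) 2" using assms(3) by simp
  ultimately have "int n dvd int k * z $ j" by (simp add: coprime_dvd_mult_right_iff)
  moreover have "int_vec (axis j k) + int_vec 0 = axis j (int k)"
    by (auto simp: int_vec_def axis_def vec_eq_iff)
  moreover have "axis j k \<noteq> 0" using assms(2) by (simp add: axis_eq_0_iff)
  ultimately show False
    using admissible_C_index_simplex_midpoint[OF C, of "axis j k" 0]
    by (simp add: index_simplex_def sum_axis scalar_product_axis cong_0_iff)
qed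

theorem proposition4p6:
  fixes k n :: nat and z :: "int ^ 'd" and \<Lambda> :: "(nat ^ 'd) set"
  assumes "k \<ge> 1" and "n \<ge> 1"
    and "\<Lambda> = index_simplex k"
  shows "(admissible_A \<Lambda> n z \<longleftrightarrow> admissible_B \<Lambda> n z) \<and>
    (admissible_B \<Lambda> n z \<longleftrightarrow>
      admissible_C \<Lambda> n z \<and> (\<forall>j. \<not> [2 * int k * z $ j = 0] (mod int n))) \<and>
    (odd n \<longrightarrow>
      (admissible_A \<Lambda> n z \<longleftrightarrow> admissible_C \<Lambda> n z) \<and>
      (admissible_B \<Lambda> n z \<longleftrightarrow> admissible_C \<Lambda> n z))"
  unfolding assms(3)
  using assms(1) admissible_A_imp_B admissible_B_imp_A_index_simplex admissible_B_imp_C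
    admissible_B_index_simplex_imp_not_cong admissible_C_imp_B_index_simplex
    admissible_C_index_simplex_odd_imp_not_cong
  by metis

end
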